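(* Let $(\tilde M^{2l+1},\phi,\xi,\eta,\tilde g)$ be an almost contact metric manifold. There is no nontrivial warped product submanifold $M^n=N_1\times_f N_2$ of $\tilde M^{2l+1}$ such that the characteristic vector field $\xi$ is tangent to the second factor $N_2$ (that is, $\xi|_{M}\in\Gamma(TN_2)$).
   Context: An almost contact metric manifold $(\tilde M^{2l+1},\phi,\xi,\eta,\tilde g)$ is an odd-dimensional smooth manifold with a $(1,1)$ tensor field $\phi$, a vector field $\xi$ (the characteristic vector field), a $1$-form $\eta$ and a Riemannian metric $\tilde g$ satisfying $\phi^2=-I+\eta\otimes\xi$, $\phi\xi=0$, $\eta\circ\phi=0$, $\eta(\xi)=1$, $\eta(X)=\tilde g(X,\xi)$, $\tilde g(\phi X,\phi Y)=\tilde g(X,Y)-\eta(X)\eta(Y)$ for all vector fields $X,Y$. Let $(N_1,g_{N_1})$, $(N_2,g_{N_2})$ be Riemannian manifolds of positive dimension and $f>0$ a smooth function on $N_1$. The warped product $N_1\times_f N_2$ is the manifold $N_1\times N_2$ with the Riemannian metric $g_{N_1}+f^2g_{N_2}$ (functions and tensors being pulled back by the projections). It is trivial if $f$ is constant, and nontrivial otherwise. A warped product submanifold of $\tilde M$ is a warped product isometrically immersed in $\tilde M$. Vector fields on a factor $N_i$ are identified with their lifts to $N_1\times N_2$: the lift of $X\in\Gamma(TN_i)$ is the unique vector field on $N_1\times N_2$ which projects to $X$ on $N_i$ and to $0$ on the other factor. "$\xi$ is tangent to $N_2$" means that $\xi$ restricted to $M$ is an element of $\Gamma(TN_2)$ in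 this sense. *)

theory Defs
  imports "HOL-Analysis.Analysis"
begin

section \<open>Smooth maps between Euclidean spaces\<close>

text \<open>\<open>k_times_cont_diff k S f\<close> is meant for open \<open>S\<close>: it says that \<open>f\<close> is of class
  \<open>C\<^sup>k\<close> on \<open>S\<close>, by recursion over all directional derivatives.\<close>

primrec k_times_cont_diff ::
  "nat \<Rightarrow> 'e::euclidean_space set \<Rightarrow> ('e \<Rightarrow> 'f::euclidean_space) \<Rightarrow> bool" where
  "k_times_cont_diff 0 S f \<longleftrightarrow> continuous_on S f"
| "k_times_cont_diff (Suc k) S f \<longleftrightarrow>
     (\<forall>x\<in>S. f differentiable (at x)) \<and>
     (\<forall>v. k_times_cont_diff k S (\<lambda>x. frechet_derivative f (at x) v))"

definition smooth_on :: "'e::euclidean_space set \<Rightarrow> ('e \<Rightarrow> 'f::euclidean_space) \<Rightarrow> bool" where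
  "smooth_on S f \<longleftrightarrow> (\<forall>k. k_times_cont_diff k S f)"


section \<open>Smooth manifolds\<close>

text \<open>A chart is a pair of a domain and a coordinate map; the coordinate map is only relevant on
  the domain, and its inverse is \<open>inv_into U x\<close>. The dimension of the manifold is \<open>DIM('e)\<close>, which
  is positive for every Euclidean space type. The atlas need not be maximal: the notions below
  depend only on the smooth structure it generates.\<close>

type_synonym ('m, 'e) chart = "'m set \<times> ('m \<Rightarrow> 'e)"

record ('m, 'e) manifold =
  mtop :: "'m topology"
  atlas :: "('m, 'e) chart set"

abbreviation points :: "('m, 'e, 'z) manifold_scheme \<Rightarrow> 'm set" where
  "points M \<equiv> topspace (mtop M)"

definition is_chart :: "'m topology \<Rightarrow> ('m, 'e::euclidean_space) chart \<Rightarrow> bool" where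
  "is_chart X c \<longleftrightarrow> (case c of (U, x) \<Rightarrow>
     openin X U \<and> open (x ` U) \<and> homeomorphic_map (subtopology X U) (top_of_set (x ` U)) x)"

text \<open>Nonemptiness is part of the definition; it excludes warped products over an empty second
  factor. Connectedness is not required.\<close>

definition smooth_manifold :: "('m, 'e::euclidean_space) manifold \<Rightarrow> bool" where
  "smooth_manifold M \<longleftrightarrow>
     points M \<noteq> {} \<and> Hausdorff_space (mtop M) \<and> second_countable (mtop M) \<and>
     (\<forall>c\<in>atlas M. is_chart (mtop M) c) \<and>
     (\<Union>(U, x)\<in>atlas M. U) = points M \<and>
     (\<forall>(U, x)\<in>atlas M. \<forall>(V, y)\<in>atlas M. smooth_on (x ` (U \<inter> V)) (y \<circ> inv_into U x))"

text \<open>Functions on a manifold are total HOL functions whose values outside \<open>points M\<close> are ignored.\<close>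

definition smooth_fun :: "('m, 'e::euclidean_space) manifold \<Rightarrow> ('m \<Rightarrow> real) \<Rightarrow> bool" where
  "smooth_fun M h \<longleftrightarrow> (\<forall>(U, x)\<in>atlas M. smooth_on (x ` U) (h \<circ> inv_into U x))"

definition smooth_map ::
  "('m, 'e::euclidean_space) manifold \<Rightarrow> ('n, 'f::euclidean_space) manifold \<Rightarrow> ('m \<Rightarrow> 'n) \<Rightarrow> bool" where
  "smooth_map M N F \<longleftrightarrow>
     continuous_map (mtop M) (mtop N) F \<and>
     (\<forall>(U, x)\<in>atlas M. \<forall>(V, y)\<in>atlas N. smooth_on (x ` (U \<inter> F -` V)) (y \<circ> F \<circ> inv_into U x))"

definition product_manifold ::
  "('m, 'e::euclidean_space) manifold \<Rightarrow> ('n, 'f::euclidean_space) manifold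
    \<Rightarrow> ('m \<times> 'n, 'e \<times> 'f) manifold" where
  "product_manifold M N =
     \<lparr> mtop = prod_topology (mtop M) (mtop N),
       atlas = {(U \<times> V, map_prod x y) | U x V y. (U, x) \<in> atlas M \<and> (V, y) \<in> atlas N} \<rparr>"


section \<open>Tangent vectors and tensor fields\<close>

text \<open>Tangent vectors at \<open>p\<close> are derivations at \<open>p\<close> of the algebra of smooth functions. They are
  set to \<open>0\<close> on nonsmooth arguments, so that equality of tangent vectors is equality of HOL
  functions. That they ignore the values of their argument outside \<open>points M\<close> is a consequence of
  the Leibniz rule: if \<open>h\<close> vanishes on \<open>points M\<close>, then \<open>h = h * k\<close> for the indicator \<open>k\<close> of
  \<open>- points M\<close>, and both factors vanish at \<open>p\<close>.\<close>

type_synonym 'm tvec = "('m \<Rightarrow> real) \<Rightarrow> real"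

definition tangent_space :: "('m, 'e::euclidean_space) manifold \<Rightarrow> 'm \<Rightarrow> 'm tvec set" where
  "tangent_space M p = {v.
     (\<forall>h k a b. smooth_fun M h \<longrightarrow> smooth_fun M k \<longrightarrow>
        v (\<lambda>q. a * h q + b * k q) = a * v h + b * v k) \<and>
     (\<forall>h k. smooth_fun M h \<longrightarrow> smooth_fun M k \<longrightarrow>
        v (\<lambda>q. h q * k q) = h p * v k + k p * v h) \<and>
     (\<forall>h. \<not> smooth_fun M h \<longrightarrow> v h = 0)}"

definition zero_tvec :: "'m tvec" where
  "zero_tvec = (\<lambda>h. 0)"

definition lincomb :: "real \<Rightarrow> 'm tvec \<Rightarrow> real \<Rightarrow> 'm tvec \<Rightarrow> 'm tvec" where
  "lincomb a v b w = (\<lambda>h. a * v h + b * w h)"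

text \<open>The differential of a smooth map \<open>F\<close> into \<open>N\<close>. It does not mention the base point, because a
  derivation at \<open>p\<close> is sent to one at \<open>F p\<close> by the same formula for all \<open>p\<close>.\<close>

definition pushforward ::
  "('n, 'f::euclidean_space) manifold \<Rightarrow> ('m \<Rightarrow> 'n) \<Rightarrow> 'm tvec \<Rightarrow> 'n tvec" where
  "pushforward N F v = (\<lambda>h. if smooth_fun N h then v (h \<circ> F) else 0)"

definition vector_field :: "('m, 'e::euclidean_space) manifold \<Rightarrow> ('m \<Rightarrow> 'm tvec) \<Rightarrow> bool" where
  "vector_field M X \<longleftrightarrow>
     (\<forall>p\<in>points M. X p \<in> tangent_space M p) \<and>
     (\<forall>h. smooth_fun M h \<longrightarrow> smooth_fun M (\<lambda>p. X p h))"

definition one_form :: "('m, 'e::euclidean_space) manifold \<Rightarrow> ('m \<Rightarrow> 'm tvec \<Rightarrow> real) \<Rightarrow> bool" where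
  "one_form M \<eta> \<longleftrightarrow>
     (\<forall>p\<in>points M. \<forall>v\<in>tangent_space M p. \<forall>w\<in>tangent_space M p. \<forall>a b.
        \<eta> p (lincomb a v b w) = a * \<eta> p v + b * \<eta> p w) \<and>
     (\<forall>X. vector_field M X \<longrightarrow> smooth_fun M (\<lambda>p. \<eta> p (X p)))"

definition tensor_field_1_1 ::
  "('m, 'e::euclidean_space) manifold \<Rightarrow> ('m \<Rightarrow> 'm tvec \<Rightarrow> 'm tvec) \<Rightarrow> bool" where
  "tensor_field_1_1 M \<phi> \<longleftrightarrow>
     (\<forall>p\<in>points M. \<forall>v\<in>tangent_space M p. \<phi> p v \<in> tangent_space M p) \<and>
     (\<forall>p\<in>points M. \<forall>v\<in>tangent_space M p. \<forall>w\<in>tangent_space M p. \<forall>a b.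
        \<phi> p (lincomb a v b w) = lincomb a (\<phi> p v) b (\<phi> p w)) \<and>
     (\<forall>X. vector_field M X \<longrightarrow> vector_field M (\<lambda>p. \<phi> p (X p)))"

definition riemannian_metric ::
  "('m, 'e::euclidean_space) manifold \<Rightarrow> ('m \<Rightarrow> 'm tvec \<Rightarrow> 'm tvec \<Rightarrow> real) \<Rightarrow> bool" where
  "riemannian_metric M g \<longleftrightarrow>
     (\<forall>p\<in>points M. \<forall>u\<in>tangent_space M p. \<forall>v\<in>tangent_space M p. \<forall>w\<in>tangent_space M p. \<forall>a b.
        g p (lincomb a u b v) w = a * g p u w + b * g p v w) \<and>
     (\<forall>p\<in>points M. \<forall>v\<in>tangent_space M p. \<forall>w\<in>tangent_space M p. g p v w = g p w v) \<and>
     (\<forall>p\<in>points M. \<forall>v\<in>tangent_space M p. v \<noteq> zero_tvec \<longrightarrow> g p v v > 0) \<and>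
     (\<forall>X Y. vector_field M X \<longrightarrow> vector_field M Y \<longrightarrow> smooth_fun M (\<lambda>p. g p (X p) (Y p)))"

definition riemannian_manifold ::
  "('m, 'e::euclidean_space) manifold \<Rightarrow> ('m \<Rightarrow> 'm tvec \<Rightarrow> 'm tvec \<Rightarrow> real) \<Rightarrow> bool" where
  "riemannian_manifold M g \<longleftrightarrow> smooth_manifold M \<and> riemannian_metric M g"


section \<open>Almost contact metric manifolds\<close>

definition almost_contact_metric_manifold ::
  "nat \<Rightarrow> ('m, 'e::euclidean_space) manifold \<Rightarrow> ('m \<Rightarrow> 'm tvec \<Rightarrow> 'm tvec) \<Rightarrow> ('m \<Rightarrow> 'm tvec)
    \<Rightarrow> ('m \<Rightarrow> 'm tvec \<Rightarrow> real) \<Rightarrow> ('m \<Rightarrow> 'm tvec \<Rightarrow> 'm tvec \<Rightarrow> real) \<Rightarrow> bool" where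
  "almost_contact_metric_manifold l M \<phi> \<xi> \<eta> g \<longleftrightarrow>
     DIM('e) = 2 * l + 1 \<and>
     riemannian_manifold M g \<and> tensor_field_1_1 M \<phi> \<and> vector_field M \<xi> \<and> one_form M \<eta> \<and>
     (\<forall>p\<in>points M. \<phi> p (\<xi> p) = zero_tvec \<and> \<eta> p (\<xi> p) = 1) \<and>
     (\<forall>X. vector_field M X \<longrightarrow> (\<forall>p\<in>points M.
        \<phi> p (\<phi> p (X p)) = lincomb (-1) (X p) (\<eta> p (X p)) (\<xi> p) \<and>
        \<eta> p (\<phi> p (X p)) = 0 \<and>
        \<eta> p (X p) = g p (X p) (\<xi> p))) \<and>
     (\<forall>X Y. vector_field M X \<longrightarrow> vector_field M Y \<longrightarrow> (\<forall>p\<in>points M.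
        g p (\<phi> p (X p)) (\<phi> p (Y p)) = g p (X p) (Y p) - \<eta> p (X p) * \<eta> p (Y p)))"


section \<open>Warped product submanifolds\<close>

definition warped_metric ::
  "('a, 'b::euclidean_space) manifold \<Rightarrow> ('a \<Rightarrow> 'a tvec \<Rightarrow> 'a tvec \<Rightarrow> real)
    \<Rightarrow> ('c, 'd::euclidean_space) manifold \<Rightarrow> ('c \<Rightarrow> 'c tvec \<Rightarrow> 'c tvec \<Rightarrow> real)
    \<Rightarrow> ('a \<Rightarrow> real) \<Rightarrow> ('a \<times> 'c \<Rightarrow> ('a \<times> 'c) tvec \<Rightarrow> ('a \<times> 'c) tvec \<Rightarrow> real)" where
  "warped_metric N1 g1 N2 g2 f = (\<lambda>p v w.
     g1 (fst p) (pushforward N1 fst v) (pushforward N1 fst w) +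
     (f (fst p))\<^sup>2 * g2 (snd p) (pushforward N2 snd v) (pushforward N2 snd w))"

definition warped_product_data ::
  "('a, 'b::euclidean_space) manifold \<Rightarrow> ('a \<Rightarrow> 'a tvec \<Rightarrow> 'a tvec \<Rightarrow> real)
    \<Rightarrow> ('c, 'd::euclidean_space) manifold \<Rightarrow> ('c \<Rightarrow> 'c tvec \<Rightarrow> 'c tvec \<Rightarrow> real)
    \<Rightarrow> ('a \<Rightarrow> real) \<Rightarrow> bool" where
  "warped_product_data N1 g1 N2 g2 f \<longleftrightarrow>
     riemannian_manifold N1 g1 \<and> riemannian_manifold N2 g2 \<and>
     smooth_fun N1 f \<and> (\<forall>p\<in>points N1. f p > 0)"

definition trivial_warping :: "('a, 'b) manifold \<Rightarrow> ('a \<Rightarrow> real) \<Rightarrow> bool" where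
  "trivial_warping N1 f \<longleftrightarrow> f constant_on points N1"

definition isometric_immersion ::
  "('n, 'f::euclidean_space) manifold \<Rightarrow> ('n \<Rightarrow> 'n tvec \<Rightarrow> 'n tvec \<Rightarrow> real)
    \<Rightarrow> ('m, 'e::euclidean_space) manifold \<Rightarrow> ('m \<Rightarrow> 'm tvec \<Rightarrow> 'm tvec \<Rightarrow> real)
    \<Rightarrow> ('n \<Rightarrow> 'm) \<Rightarrow> bool" where
  "isometric_immersion N h M g \<iota> \<longleftrightarrow>
     smooth_map N M \<iota> \<and>
     (\<forall>p\<in>points N. inj_on (pushforward M \<iota>) (tangent_space N p)) \<and>
     (\<forall>p\<in>points N. \<forall>v\<in>tangent_space N p. \<forall>w\<in>tangent_space N p.
        g (\<iota> p) (pushforward M \<iota> v) (pushforward M \<iota> w) = h p v w)"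

definition warped_product_submanifold ::
  "('m, 'e::euclidean_space) manifold \<Rightarrow> ('m \<Rightarrow> 'm tvec \<Rightarrow> 'm tvec \<Rightarrow> real)
    \<Rightarrow> ('a, 'b::euclidean_space) manifold \<Rightarrow> ('a \<Rightarrow> 'a tvec \<Rightarrow> 'a tvec \<Rightarrow> real)
    \<Rightarrow> ('c, 'd::euclidean_space) manifold \<Rightarrow> ('c \<Rightarrow> 'c tvec \<Rightarrow> 'c tvec \<Rightarrow> real)
    \<Rightarrow> ('a \<Rightarrow> real) \<Rightarrow> ('a \<times> 'c \<Rightarrow> 'm) \<Rightarrow> bool" where
  "warped_product_submanifold M g N1 g1 N2 g2 f \<iota> \<longleftrightarrow>
     warped_product_data N1 g1 N2 g2 f \<and>
     isometric_immersion (product_manifold N1 N2) (warped_metric N1 g1 N2 g2 f) M g \<iota>"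

definition is_lift_of_second ::
  "('a, 'b::euclidean_space) manifold \<Rightarrow> ('c, 'd::euclidean_space) manifold
    \<Rightarrow> ('c \<Rightarrow> 'c tvec) \<Rightarrow> ('a \<times> 'c \<Rightarrow> ('a \<times> 'c) tvec) \<Rightarrow> bool" where
  "is_lift_of_second N1 N2 X Z \<longleftrightarrow>
     vector_field (product_manifold N1 N2) Z \<and>
     (\<forall>p\<in>points (product_manifold N1 N2).
        pushforward N1 fst (Z p) = zero_tvec \<and> pushforward N2 snd (Z p) = X (snd p))"

text \<open>\<open>tangent_to_second M \<xi> N1 N2 \<iota>\<close>: the restriction of \<open>\<xi>\<close> along \<open>\<iota>\<close> is the image under the
  differential of \<open>\<iota>\<close> of the lift of a vector field on \<open>N2\<close>.\<close>

definition tangent_to_second ::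
  "('m, 'e::euclidean_space) manifold \<Rightarrow> ('m \<Rightarrow> 'm tvec)
    \<Rightarrow> ('a, 'b::euclidean_space) manifold \<Rightarrow> ('c, 'd::euclidean_space) manifold
    \<Rightarrow> ('a \<times> 'c \<Rightarrow> 'm) \<Rightarrow> bool" where
  "tangent_to_second M \<xi> N1 N2 \<iota> \<longleftrightarrow>
     (\<exists>X Z. vector_field N2 X \<and> is_lift_of_second N1 N2 X Z \<and>
        (\<forall>p\<in>points (product_manifold N1 N2). pushforward M \<iota> (Z p) = \<xi> (\<iota> p)))"

end

theory Submission
  imports Defs
begin

text \<open>The characteristic field \<open>\<xi>\<close> has length 1 everywhere. If along the submanifold it is the lift
  of a field \<open>X\<close> on the second factor, then the warped product metric computes its squared length at
  \<open>(a, c)\<close> as \<open>f(a)\<^sup>2 \<cdot> |X(c)|\<^sup>2\<close>. Holding \<open>c\<close> fixed, this product equals 1 for all \<open>a\<close>, so the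
  positive function \<open>f\<close> is constant.\<close>

lemma riemannian_metric_zero:
  fixes M :: "('m, 'e::euclidean_space) manifold"
  assumes "riemannian_metric M g" and "p \<in> points M"
  shows "g p zero_tvec zero_tvec = 0"
proof -
  have "zero_tvec \<in> tangent_space M p"
    by (simp add: zero_tvec_def tangent_space_def)
  then have "g p (lincomb 0 zero_tvec 0 zero_tvec) zero_tvec =
      0 * g p zero_tvec zero_tvec + 0 * g p zero_tvec zero_tvec"
    using assms unfolding riemannian_metric_def by blast
  moreover have "lincomb 0 zero_tvec 0 zero_tvec = (zero_tvec :: 'm tvec)"
    by (simp add: lincomb_def zero_tvec_def)
  ultimately show ?thesis by simp
qed

text \<open>Both \<open>\<eta>(\<xi>) = 1\<close> and \<open>\<eta> = g(\<cdot>, \<xi>)\<close> are axioms; evaluating the second at \<open>\<xi>\<close> itself gives the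
  length.\<close>

lemma characteristic_field_unit_length:
  assumes "almost_contact_metric_manifold l M \<phi> \<xi> \<eta> g" and "q \<in> points M"
  shows "g q (\<xi> q) (\<xi> q) = 1"
proof -
  have "vector_field M \<xi>" and "\<eta> q (\<xi> q) = 1"
    and "\<And>X. vector_field M X \<Longrightarrow> \<eta> q (X q) = g q (X q) (\<xi> q)"
    using assms unfolding almost_contact_metric_manifold_def by blast+
  then show ?thesis by metis
qed

lemma warped_metric_lift_of_second:
  assumes "riemannian_metric N1 g1" and "is_lift_of_second N1 N2 X Z"
    and "a \<in> points N1" and "c \<in> points N2"
  shows "warped_metric N1 g1 N2 g2 f (a, c) (Z (a, c)) (Z (a, c)) = (f a)\<^sup>2 * g2 c (X c) (X c)"
proof -
  have "(a, c) \<in> points (product_manifold N1 N2)"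
    using assms(3,4) by (simp add: product_manifold_def)
  then have "pushforward N1 fst (Z (a, c)) = zero_tvec"
    and "pushforward N2 snd (Z (a, c)) = X c"
    using assms(2) unfolding is_lift_of_second_def by auto
  then show ?thesis
    using riemannian_metric_zero[OF assms(1,3)] by (simp add: warped_metric_def)
qed

theorem theorem4p2:
  fixes M :: "('m, 'e::euclidean_space) manifold"
    and l :: nat
    and \<phi> :: "'m \<Rightarrow> 'm tvec \<Rightarrow> 'm tvec"
    and \<xi> :: "'m \<Rightarrow> 'm tvec"
    and \<eta> :: "'m \<Rightarrow> 'm tvec \<Rightarrow> real"
    and g :: "'m \<Rightarrow> 'm tvec \<Rightarrow> 'm tvec \<Rightarrow> real"
  assumes "almost_contact_metric_manifold l M \<phi> \<xi> \<eta> g"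
  shows "\<not> (\<exists>(N1 :: ('a, 'b::euclidean_space) manifold) g1
              (N2 :: ('c, 'd::euclidean_space) manifold) g2 f \<iota>.
            warped_product_submanifold M g N1 g1 N2 g2 f \<iota> \<and>
            \<not> trivial_warping N1 f \<and>
            tangent_to_second M \<xi> N1 N2 \<iota>)"
proof clarify
  fix N1 :: "('a, 'b) manifold" and g1 and N2 :: "('c, 'd) manifold" and g2 f \<iota>
  assume sub: "warped_product_submanifold M g N1 g1 N2 g2 f \<iota>"
    and nontrivial: "\<not> trivial_warping N1 f"
    and tangent: "tangent_to_second M \<xi> N1 N2 \<iota>"
  let ?N = "product_manifold N1 N2"
  have metric1: "riemannian_metric N1 g1" and man2: "smooth_manifold N2"
    and f_pos: "\<And>a. a \<in> points N1 \<Longrightarrow> f a > 0"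
    and immersion: "isometric_immersion ?N (warped_metric N1 g1 N2 g2 f) M g \<iota>"
    using sub
    unfolding warped_product_submanifold_def warped_product_data_def riemannian_manifold_def
    by blast+
  obtain X Z where lift: "is_lift_of_second N1 N2 X Z"
    and \<xi>_eq: "\<And>p. p \<in> points ?N \<Longrightarrow> pushforward M \<iota> (Z p) = \<xi> (\<iota> p)"
    using tangent unfolding tangent_to_second_def by blast
  have unit: "warped_metric N1 g1 N2 g2 f p (Z p) (Z p) = 1" if p: "p \<in> points ?N" for p
  proof -
    have "Z p \<in> tangent_space ?N p"
      using lift p unfolding is_lift_of_second_def vector_field_def by blast
    then have "warped_metric N1 g1 N2 g2 f p (Z p) (Z p) = g (\<iota> p) (\<xi> (\<iota> p)) (\<xi> (\<iota> p))"
      using immersion p \<xi>_eq[OF p] unfolding isometric_immersion_def by metis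
    moreover have "\<iota> p \<in> points M"
      using immersion p
      unfolding isometric_immersion_def smooth_map_def continuous_map_def by blast
    ultimately show ?thesis
      using characteristic_field_unit_length[OF assms] by simp
  qed
  obtain c where c: "c \<in> points N2"
    using man2 unfolding smooth_manifold_def by blast
  have f_sq: "(f a)\<^sup>2 * g2 c (X c) (X c) = 1" if "a \<in> points N1" for a
    using unit[of "(a, c)"] warped_metric_lift_of_second[OF metric1 lift that c] that c
    by (simp add: product_manifold_def)
  have "f a = f b" if a: "a \<in> points N1" and b: "b \<in> points N1" for a b
  proof -
    have "(f a)\<^sup>2 = (f b)\<^sup>2"
      using f_sq[OF a] f_sq[OF b] by (metis mult_right_cancel mult_zero_right zero_neq_one)
    then show ?thesis
      using f_pos[OF a] f_pos[OF b] by (simp add: power2_eq_iff_nonneg)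
  qed
  then have "trivial_warping N1 f"
    unfolding trivial_warping_def constant_on_def by blast
  then show False
    using nontrivial by contradiction
qed

end
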